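(* Let $G$ be a group with finite generating set $\mathcal G$. If there is an algorithm running in polynomial time and space which, given a word $w$ in $\mathcal G^{\pm 1}$ and an integer $k$, decides whether a geodesic representative for $w$ has length $\leq k$ (Problem 5), then there is an algorithm running in polynomial time and space which, given a geodesic word $u$ in $\mathcal G^{\pm 1}$ and a generator $x\in\mathcal G$, decides whether $\ell(ux)-\ell(u)=0$, $1$ or $-1$ (Problem 1).
   Context: The group $G$ and the finite generating set $\mathcal G$ are fixed. Words are elements of $(\mathcal G^{\pm 1})^*$. A geodesic representative of a word $w$ is a word in $(\mathcal G^{\pm 1})^*$ of minimal length among all words representing the same element of $G$ as $w$; $\ell(w)$ denotes the length of a geodesic representative of $w$. A word $u$ is geodesic if its length equals $\ell(u)$. Polynomial time and space means bounded by a polynomial in the length of the encoding of the input. *)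

theory Defs
  imports "HOL-Algebra.Generated_Groups" "HOL-Computational_Algebra.Polynomial"
begin

text \<open>The letter \<open>(g, True)\<close> is the generator \<open>g\<close>, and \<open>(g, False)\<close> is its formal inverse.\<close>

type_synonym 'a letter = "'a \<times> bool"

definition words :: "'a set \<Rightarrow> 'a letter list set" where
  "words S = lists (S \<times> UNIV)"

definition letter_value :: "('a, 'b) monoid_scheme \<Rightarrow> 'a letter \<Rightarrow> 'a" where
  "letter_value G l = (if snd l then fst l else inv\<^bsub>G\<^esub> fst l)"

definition word_value :: "('a, 'b) monoid_scheme \<Rightarrow> 'a letter list \<Rightarrow> 'a" where
  "word_value G w = foldr (\<lambda>l h. letter_value G l \<otimes>\<^bsub>G\<^esub> h) w \<one>\<^bsub>G\<^esub>"

definition geodesic_rep ::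
  "('a, 'b) monoid_scheme \<Rightarrow> 'a set \<Rightarrow> 'a letter list \<Rightarrow> 'a letter list \<Rightarrow> bool" where
  "geodesic_rep G S w v \<longleftrightarrow>
     is_arg_min length (\<lambda>v. v \<in> words S \<and> word_value G v = word_value G w) v"

definition geodesic_length :: "('a, 'b) monoid_scheme \<Rightarrow> 'a set \<Rightarrow> 'a letter list \<Rightarrow> nat" where
  "geodesic_length G S w = length (SOME v. geodesic_rep G S w v)"

definition geodesic_word :: "('a, 'b) monoid_scheme \<Rightarrow> 'a set \<Rightarrow> 'a letter list \<Rightarrow> bool" where
  "geodesic_word G S u \<longleftrightarrow> u \<in> words S \<and> length u = geodesic_length G S u"

text \<open>
  The answer of a machine is read off from the state in which it halts: \<open>verdict M q = None\<close>
  means that \<open>q\<close> is not a halting state. With answers in \<open>bool\<close> this is the usual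
  convention of accepting and rejecting states.
\<close>

datatype 'i symbol = Blank | Input 'i | Work nat

datatype move = Left | Stay | Right

record ('i, 'v) tm =
  tape_count :: nat
  state_count :: nat
  alphabet :: "'i symbol set"
  delta :: "nat \<Rightarrow> 'i symbol list \<Rightarrow> nat \<times> ('i symbol \<times> move) list"
  verdict :: "nat \<Rightarrow> 'v option"

text \<open>
  States are the numbers below \<open>state_count M\<close>, and \<open>0\<close> is the initial state. Together with the
  finiteness of the alphabet, the following makes the relevant part of \<open>delta M\<close> a finite table.
\<close>

definition wf_tm :: "('i, 'v) tm \<Rightarrow> bool" where
  "wf_tm M \<longleftrightarrow>
     0 < tape_count M \<and> 0 < state_count M \<and> finite (alphabet M) \<and> Blank \<in> alphabet M \<and>
     (\<forall>q < state_count M. \<forall>ss. verdict M q = None \<and> length ss = tape_count M \<and> set ss \<subseteq> alphabet M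
        \<longrightarrow> (case delta M q ss of (q', as) \<Rightarrow>
              q' < state_count M \<and> length as = tape_count M \<and> fst ` set as \<subseteq> alphabet M))"

text \<open>A tape is infinite in both directions; it is given by its contents and its head position.\<close>

type_synonym 'i tape = "(int \<Rightarrow> 'i symbol) \<times> int"

type_synonym 'i config = "nat \<times> 'i tape list"

definition read_tape :: "'i tape \<Rightarrow> 'i symbol" where
  "read_tape t = fst t (snd t)"

fun move_head :: "move \<Rightarrow> int \<Rightarrow> int" where
  "move_head Left h = h - 1"
| "move_head Stay h = h"
| "move_head Right h = h + 1"

fun act_tape :: "'i symbol \<times> move \<Rightarrow> 'i tape \<Rightarrow> 'i tape" where
  "act_tape (s, m) (f, h) = (f(h := s), move_head m h)"

definition step :: "('i, 'v) tm \<Rightarrow> 'i config \<Rightarrow> 'i config" where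
  "step M c = (case c of (q, ts) \<Rightarrow>
     (if verdict M q \<noteq> None then c
      else (case delta M q (map read_tape ts) of (q', as) \<Rightarrow> (q', map2 act_tape as ts))))"

definition input_tape :: "'i list \<Rightarrow> 'i tape" where
  "input_tape xs =
     (\<lambda>i. if 0 \<le> i \<and> nat i < length xs then Input (xs ! nat i) else Blank, 0)"

definition start_config :: "('i, 'v) tm \<Rightarrow> 'i list \<Rightarrow> 'i config" where
  "start_config M xs = (0, input_tape xs # replicate (tape_count M - 1) (input_tape []))"

definition config_at :: "('i, 'v) tm \<Rightarrow> 'i list \<Rightarrow> nat \<Rightarrow> 'i config" where
  "config_at M xs t = (step M ^^ t) (start_config M xs)"

definition answer_at :: "('i, 'v) tm \<Rightarrow> 'i list \<Rightarrow> nat \<Rightarrow> 'v option" where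
  "answer_at M xs t = verdict M (fst (config_at M xs t))"

text \<open>The number of tape cells, over all tapes, that are scanned during the first \<open>t\<close> steps.\<close>

definition cells_used :: "('i, 'v) tm \<Rightarrow> 'i list \<Rightarrow> nat \<Rightarrow> nat" where
  "cells_used M xs t =
     card {(i, snd (snd (config_at M xs t') ! i)) | i t'. i < tape_count M \<and> t' \<le> t}"

text \<open>
  A problem consists of a set of instances \<open>X\<close>, an encoding \<open>enc\<close> of the instances as strings,
  and a relation \<open>correct\<close> between instances and answers. Nothing is required on
  strings that do not encode an instance. Since \<open>step\<close> fixes halting configurations, an answer
  at time \<open>poly p n\<close> means that the machine halts within \<open>poly p n\<close> steps.
\<close>

definition poly_time_space_solves ::
  "('i, 'v) tm \<Rightarrow> 'x set \<Rightarrow> ('x \<Rightarrow> 'i list) \<Rightarrow> ('x \<Rightarrow> 'v \<Rightarrow> bool) \<Rightarrow> bool" where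
  "poly_time_space_solves M X enc correct \<longleftrightarrow>
     wf_tm M \<and>
     (\<forall>x\<in>X. Input ` set (enc x) \<subseteq> alphabet M) \<and>
     (\<exists>p q :: nat poly. \<forall>x\<in>X.
        (\<exists>v. answer_at M (enc x) (poly p (length (enc x))) = Some v \<and> correct x v) \<and>
        cells_used M (enc x) (poly p (length (enc x))) \<le> poly q (length (enc x)))"

datatype 'a input_symbol = Letter "'a letter" | Bit bool | Minus | Sep

text \<open>Least significant digit first; \<open>0\<close> has no digits.\<close>

fun binary_digits :: "nat \<Rightarrow> bool list" where
  "binary_digits n = (if n = 0 then [] else odd n # binary_digits (n div 2))"

declare binary_digits.simps [simp del]

definition encode_int :: "int \<Rightarrow> 'a input_symbol list" where
  "encode_int k = (if k < 0 then [Minus] else []) @ map Bit (rev (binary_digits (nat \<bar>k\<bar>)))"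

definition encode_word_int :: "'a letter list \<times> int \<Rightarrow> 'a input_symbol list" where
  "encode_word_int = (\<lambda>(w, k). map Letter w @ [Sep] @ encode_int k)"

definition encode_word_gen :: "'a letter list \<times> 'a \<Rightarrow> 'a input_symbol list" where
  "encode_word_gen = (\<lambda>(u, x). map Letter u @ [Sep] @ [Letter (x, True)])"

definition bounded_geodesic_length_algorithm ::
  "('a, 'b) monoid_scheme \<Rightarrow> 'a set \<Rightarrow> ('a input_symbol, bool) tm \<Rightarrow> bool" where
  "bounded_geodesic_length_algorithm G S M \<longleftrightarrow>
     poly_time_space_solves M {(w, k). w \<in> words S} encode_word_int
       (\<lambda>(w, k) b. b \<longleftrightarrow> int (geodesic_length G S w) \<le> k)"

definition geodesic_extension_algorithm ::
  "('a, 'b) monoid_scheme \<Rightarrow> 'a set \<Rightarrow> ('a input_symbol, int) tm \<Rightarrow> bool" where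
  "geodesic_extension_algorithm G S M \<longleftrightarrow>
     poly_time_space_solves M {(u, x). geodesic_word G S u \<and> x \<in> S} encode_word_gen
       (\<lambda>(u, x) d. d \<in> {0, 1, -1} \<and>
          int (geodesic_length G S (u @ [(x, True)])) - int (geodesic_length G S u) = d)"

end

theory Submission imports Defs
begin

text \<open>
  A geodesic word \<open>u\<close> of length \<open>n\<close> satisfies \<open>n - 1 \<le> \<ell>(ux) \<le> n + 1\<close>, so the sign of \<open>\<ell>(ux) - n\<close>
  is determined by the answers of the given machine \<open>M\<close> on \<open>(ux, n)\<close> and \<open>(ux, n - 1)\<close>. The new machine
  has an input tape and the tapes of two copies of \<open>M\<close>: it counts the letters of \<open>u\<close> in binary on
  both copies, writes \<open>ux\<close> in front of the counters and then runs the copies in parallel. If \<open>u\<close> is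
  empty, the answer depends on \<open>x\<close> only and is looked up in a finite table.
\<close>

text \<open>A run of \<open>M\<close> may overwrite its tapes, so the two queries, although about
  the same word, get separate tapes. They need not end at the same time, hence a copy that has
  halted idles until both verdicts are known. For an empty \<open>u\<close> the second query would
  concern the number -1, which an unsigned counter cannot hold; that is why this case is split off.
  A counter grows to the left. The word can therefore be put in front of it only after counting is
  over, and writing leftwards forces the input to be read from right to left. \<open>M\<close> is
  known to be correct only when started on an encoded instance, so the preparation has to end in
  exact start configurations up to translation: head on the first symbol, blanks everywhere
  else.\<close>

text \<open>
  A view describes a tape relative to its head. The strings that the machine prepares do not start
  at cell \<open>0\<close>, but in terms of views they cannot be distinguished from input tapes.
\<close>

type_synonym 'i view = "int \<Rightarrow> 'i symbol"

definition tape_view :: "'i tape \<Rightarrow> 'i view" where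
  "tape_view t = (\<lambda>i. fst t (snd t + i))"

definition view_act :: "'i symbol \<times> move \<Rightarrow> 'i view \<Rightarrow> 'i view" where
  "view_act a v = (\<lambda>i. (v(0 := fst a)) (i + move_head (snd a) 0))"

lemma tape_view_act: "tape_view (act_tape a t) = view_act a (tape_view t)"
proof (cases a; cases t)
  fix s m f h assume "a = (s, m)" "t = (f, h)"
  then show ?thesis by (cases m) (auto simp: tape_view_def view_act_def fun_eq_iff algebra_simps)
qed

lemma view_act_Stay [simp]: "view_act (v 0, Stay) v = v"
  by (auto simp: view_act_def fun_eq_iff)

text \<open>The state type is left open so that the same step function serves \<open>M\<close>,
  whose states are numbers, and the new machine, whose states form a datatype.\<close>

definition view_step ::
  "('s \<Rightarrow> 'i symbol list \<Rightarrow> 's \<times> ('i symbol \<times> move) list) \<Rightarrow> ('s \<Rightarrow> 'v option)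
     \<Rightarrow> 's \<times> 'i view list \<Rightarrow> 's \<times> 'i view list" where
  "view_step D V c = (case c of (q, vs) \<Rightarrow>
     (if V q \<noteq> None then c
      else (case D q (map (\<lambda>v. v 0) vs) of (q', as) \<Rightarrow> (q', map2 view_act as vs))))"

definition config_view :: "'i config \<Rightarrow> nat \<times> 'i view list" where
  "config_view c = (fst c, map tape_view (snd c))"

lemma fst_config_view [simp]: "fst (config_view c) = fst c"
  by (simp add: config_view_def)

lemma config_view_step:
  "config_view (step M c) = view_step (delta M) (verdict M) (config_view c)"
proof (cases c)
  case (Pair q ts)
  obtain q' as where D: "delta M q (map read_tape ts) = (q', as)" by force
  have "map (\<lambda>v. v 0) (map tape_view ts) = map read_tape ts"
    by (simp add: tape_view_def read_tape_def)
  moreover have "map tape_view (map2 act_tape as ts) = map2 view_act as (map tape_view ts)"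
    by (rule nth_equalityI) (auto simp: tape_view_act)
  ultimately show ?thesis
    using D Pair by (simp add: config_view_def step_def view_step_def del: map_map)
qed

text \<open>In \<open>zipper l r\<close> the first symbol of \<open>l\<close> is the one next to the head.\<close>

definition zipper :: "'i symbol list \<Rightarrow> 'i symbol list \<Rightarrow> 'i view" where
  "zipper l r = (\<lambda>i. if i < 0 then (if nat (- i - 1) < length l then l ! nat (- i - 1) else Blank)
     else (if nat i < length r then r ! nat i else Blank))"

text \<open>Beyond the listed symbols a tape is blank, whereas \<open>hd []\<close> is
  unspecified.\<close>

definition head_symbol :: "'i symbol list \<Rightarrow> 'i symbol" where
  "head_symbol r = (if r = [] then Blank else hd r)"

lemma head_symbol_simps [simp]: "head_symbol [] = Blank" "head_symbol (s # r) = s"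
  by (simp_all add: head_symbol_def)

lemma zipper_0 [simp]: "zipper l r 0 = head_symbol r"
  by (cases r) (auto simp: zipper_def)

lemma zipper_Stay [simp]: "view_act (s, Stay) (zipper l r) = zipper l (s # tl r)"
  by (cases r) (auto simp: view_act_def zipper_def fun_eq_iff nth_Cons' nat_diff_distrib)

lemma zipper_Right [simp]: "view_act (s, Right) (zipper l r) = zipper (s # l) (tl r)"
proof
  fix i :: int
  consider "i < -1" | "i = -1" | "0 \<le> i" by linarith
  then show "view_act (s, Right) (zipper l r) i = zipper (s # l) (tl r) i"
  proof cases
    case 1
    then have "nat (- i - 1) = Suc (nat (- 2 - i))" by linarith
    with 1 show ?thesis by (simp add: view_act_def zipper_def)
  next
    case 3
    then show ?thesis by (cases r) (auto simp: view_act_def zipper_def nat_add_distrib)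
  qed (simp add: view_act_def zipper_def)
qed

lemma zipper_Left [simp]:
  "view_act (s, Left) (zipper l r) = zipper (tl l) (head_symbol l # s # tl r)"
proof
  fix i :: int
  consider "i < 0" | "i = 0" | "i = 1" | "2 \<le> i" by linarith
  then show "view_act (s, Left) (zipper l r) i = zipper (tl l) (head_symbol l # s # tl r) i"
  proof cases
    case 1
    then have "nat (- (i - 1) - 1) = Suc (nat (- i - 1))" by linarith
    with 1 show ?thesis by (cases l) (auto simp: view_act_def zipper_def)
  next
    case 2
    then show ?thesis by (cases l) (auto simp: view_act_def zipper_def)
  next
    case 4
    then obtain n where "i = int n + 2" by (metis zle_iff_zadd add.commute)
    then show ?thesis by (cases r) (auto simp: view_act_def zipper_def nat_add_distrib)
  qed (simp add: view_act_def zipper_def)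
qed

lemma zipper_head_tl [simp]: "zipper l (head_symbol r # tl r) = zipper l r"
  by (cases r) (auto simp: zipper_def fun_eq_iff nth_Cons')

text \<open>Blanks at the far end of a list are invisible in the view. As simplification rules these
  equations give normal forms when a head leaves the written part of a tape.\<close>

lemma zipper_trim [simp]:
  "zipper l [Blank] = zipper l []" "zipper l [s, Blank] = zipper l [s]"
  "zipper [Blank] r = zipper [] r"
  by (auto simp: zipper_def fun_eq_iff nth_Cons')

definition start_views :: "nat \<Rightarrow> 'i list \<Rightarrow> 'i view list" where
  "start_views k xs = zipper [] (map Input xs) # replicate (k - 1) (zipper [] [])"

lemma config_view_start: "config_view (start_config M xs) = (0, start_views (tape_count M) xs)"
proof -
  have "tape_view (input_tape ys) = zipper [] (map Input ys)" for ys :: "'a list"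
    by (auto simp: tape_view_def input_tape_def zipper_def fun_eq_iff)
  then show ?thesis by (simp add: config_view_def start_config_def start_views_def)
qed

lemma config_view_at:
  "config_view (config_at M xs t)
     = (view_step (delta M) (verdict M) ^^ t) (0, start_views (tape_count M) xs)"
  by (induction t) (simp_all add: config_at_def config_view_start config_view_step)

lemma answer_at_view:
  "answer_at M xs t
     = verdict M (fst ((view_step (delta M) (verdict M) ^^ t) (0, start_views (tape_count M) xs)))"
  by (simp add: answer_at_def flip: config_view_at)

lemma view_step_halted: "V (fst c) \<noteq> None \<Longrightarrow> (view_step D V ^^ t) c = c"
  by (induction t) (auto simp: view_step_def split: prod.splits)

lemma view_step_answer_mono:
  assumes "V (fst ((view_step D V ^^ s) c)) = Some v" "s \<le> t"
  shows "V (fst ((view_step D V ^^ t) c)) = Some v"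
proof -
  obtain r where "t = r + s" using assms(2) by (metis add.commute le_Suc_ex)
  then show ?thesis using assms(1) by (simp add: funpow_add view_step_halted)
qed

lemma answer_at_mono: "answer_at M xs s = Some v \<Longrightarrow> s \<le> t \<Longrightarrow> answer_at M xs t = Some v"
  unfolding answer_at_view by (rule view_step_answer_mono)

section \<open>Turing machines from finite tables with arbitrary states\<close>

definition closed_table ::
  "'s set \<Rightarrow> 'i symbol set \<Rightarrow> nat \<Rightarrow> ('s \<Rightarrow> 'i symbol list \<Rightarrow> 's \<times> ('i symbol \<times> move) list)
     \<Rightarrow> ('s \<Rightarrow> 'v option) \<Rightarrow> bool" where
  "closed_table Q A k D V \<longleftrightarrow>
     (\<forall>q\<in>Q. \<forall>ss. V q = None \<and> length ss = k \<and> set ss \<subseteq> A \<longrightarrow>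
        (case D q ss of (q', as) \<Rightarrow> q' \<in> Q \<and> length as = k \<and> fst ` set as \<subseteq> A))"

text \<open>The invariant under which a closed table applies. The number of views is part of it
  because \<open>map2\<close> silently truncates to the shorter list.\<close>

definition valid_config :: "'s set \<Rightarrow> 'i symbol set \<Rightarrow> nat \<Rightarrow> 's \<times> 'i view list \<Rightarrow> bool" where
  "valid_config Q A k c \<longleftrightarrow> fst c \<in> Q \<and> length (snd c) = k \<and> (\<forall>v\<in>set (snd c). range v \<subseteq> A)"

lemma range_view_act: "range v \<subseteq> A \<Longrightarrow> fst a \<in> A \<Longrightarrow> range (view_act a v) \<subseteq> A"
  by (auto simp: view_act_def)

lemma valid_config_step:
  assumes "closed_table Q A k D V" "valid_config Q A k c"
  shows "valid_config Q A k (view_step D V c)"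
proof (cases c)
  case (Pair q vs)
  obtain q' as where D: "D q (map (\<lambda>v. v 0) vs) = (q', as)" by force
  show ?thesis
  proof (cases "V q = None")
    case True
    have "set (map (\<lambda>v. v 0) vs) \<subseteq> A" "length vs = k" "q \<in> Q" and vs: "\<forall>v\<in>set vs. range v \<subseteq> A"
      using assms(2) Pair by (auto simp: valid_config_def)
    then have *: "q' \<in> Q" "length as = k" "fst ` set as \<subseteq> A"
      using assms(1) True D unfolding closed_table_def
      by (metis (mono_tags, lifting) case_prod_conv length_map)+
    have "range v \<subseteq> A" if "v \<in> set (map2 view_act as vs)" for v
    proof -
      have "v \<in> (\<lambda>p. view_act (fst p) (snd p)) ` set (zip as vs)"
        using that by (simp add: case_prod_beta')
      then obtain p where "p \<in> set (zip as vs)" and p: "v = view_act (fst p) (snd p)"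
        by blast
      then have "fst p \<in> set as" "snd p \<in> set vs"
        by (metis prod.collapse set_zip_leftD set_zip_rightD)+
      then show ?thesis using *(3) vs p by (metis image_subset_iff range_view_act)
    qed
    then show ?thesis using * \<open>length vs = k\<close> True D Pair
      unfolding valid_config_def by (auto simp: view_step_def)
  next
    case False
    then show ?thesis using assms(2) Pair by (simp add: view_step_def)
  qed
qed

lemma valid_config_steps:
  assumes "closed_table Q A k D V" "valid_config Q A k c"
  shows "valid_config Q A k ((view_step D V ^^ t) c)"
proof (induction t)
  case (Suc t)
  then show ?case using valid_config_step[OF assms(1)] by simp
qed (use assms in simp)

lemma valid_start:
  assumes "q \<in> Q" "Blank \<in> A" "Input ` set xs \<subseteq> A" "0 < k"
  shows "valid_config Q A k (q, start_views k xs)"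
  using assms by (auto simp: valid_config_def start_views_def zipper_def)

lemma closed_table_tm:
  "wf_tm M \<Longrightarrow> closed_table {..<state_count M} (alphabet M) (tape_count M) (delta M) (verdict M)"
  by (auto simp: wf_tm_def closed_table_def)

text \<open>Renumbering the states along a bijection turns any closed finite table into a
  \<open>tm\<close> with the same answers.\<close>

lemma tm_of_table:
  fixes V :: "'s \<Rightarrow> 'v option"
  assumes "finite Q" "q0 \<in> Q" "finite A" "Blank \<in> A" "0 < k" "closed_table Q A k D V"
  obtains N :: "('i, 'v) tm" where "wf_tm N" "alphabet N = A"
    "\<And>xs t. Input ` set xs \<subseteq> A \<Longrightarrow>
       answer_at N xs t = V (fst ((view_step D V ^^ t) (q0, start_views k xs)))"
proof -
  define c where "c = card (Q - {q0})"
  \<comment> \<open>A \<open>tm\<close> starts in state 0, so \<open>q0\<close> is set aside and the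
    remaining states are enumerated from 1 on.\<close>
  obtain h where h: "bij_betw h (Q - {q0}) {0..<c}"
    unfolding c_def using ex_bij_betw_finite_nat assms(1) by blast
  have card: "card Q = Suc c"
    unfolding c_def using assms(1,2) by (rule card.remove)
  define f where "f q = (if q = q0 then 0 else Suc (h q))" for q
  have "inj_on f Q"
    using h by (auto simp: f_def inj_on_def bij_betw_def)
  moreover have "f ` Q = insert 0 (Suc ` h ` (Q - {q0}))"
    using assms(2) by (auto simp: f_def)
  then have "f ` Q = {0..<card Q}"
    using h card by (auto simp: bij_betw_def image_Suc_atLeastLessThan)
  ultimately have f: "bij_betw f Q {0..<card Q}" "f q0 = 0"
    by (simp_all add: bij_betw_def f_def)
  define g where "g = inv_into Q f"
  have g: "g n \<in> Q" if "n < card Q" for n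
    using f(1) that by (metis atLeast0LessThan bij_betw_imp_surj_on g_def inv_into_into lessThan_iff)
  have gf: "g (f q) = q" if "q \<in> Q" for q
    using f(1) that by (auto simp: g_def bij_betw_def)
  have fQ: "f q < card Q" if "q \<in> Q" for q
    using f(1) that by (auto simp: bij_betw_def)
  define N :: "('i, 'v) tm" where
    "N = \<lparr>tape_count = k, state_count = card Q, alphabet = A,
          delta = (\<lambda>n ss. apfst f (D (g n) ss)), verdict = V \<circ> g\<rparr>"
  have N [simp]: "tape_count N = k" "state_count N = card Q" "alphabet N = A"
    "delta N n ss = apfst f (D (g n) ss)" "verdict N n = V (g n)" for n ss
    by (simp_all add: N_def)
  have "wf_tm N"
    unfolding wf_tm_def N
  proof (intro conjI allI impI)
    fix q ss assume "q < card Q" and ss: "V (g q) = None \<and> length ss = k \<and> set ss \<subseteq> A"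
    obtain q' as where D: "D (g q) ss = (q', as)" by force
    have "q' \<in> Q \<and> length as = k \<and> fst ` set as \<subseteq> A"
      using assms(6) ss g[OF \<open>q < card Q\<close>] D unfolding closed_table_def by fastforce
    then show "case apfst f (D (g q) ss) of (q', as) \<Rightarrow>
        q' < card Q \<and> length as = k \<and> fst ` set as \<subseteq> A"
      using fQ D by simp
  qed (use assms card in auto)
  moreover have "answer_at N xs t = V (fst ((view_step D V ^^ t) (q0, start_views k xs)))"
    if "Input ` set xs \<subseteq> A" for xs t
  proof -
    let ?c = "\<lambda>t. (view_step D V ^^ t) (q0, start_views k xs)"
    have valid: "valid_config Q A k (?c t)" for t
      by (intro valid_config_steps valid_start) (use assms that in auto)
    \<comment> \<open>Decoding inverts \<open>f\<close> on \<open>Q\<close> only;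
      \<open>valid\<close> guarantees that reachable states stay there.\<close>
    have sim: "view_step (delta N) (verdict N) (apfst f c) = apfst f (view_step D V c)"
      if "fst c \<in> Q" for c
      using that gf by (cases c) (auto simp: view_step_def split: prod.splits)
    have "(view_step (delta N) (verdict N) ^^ t) (0, start_views k xs) = apfst f (?c t)"
    proof (induction t)
      case 0
      then show ?case by (simp add: f(2))
    next
      case (Suc t)
      have "fst (?c t) \<in> Q" using valid by (simp add: valid_config_def)
      from Suc sim[OF this] show ?case by (simp only: funpow.simps comp_apply)
    qed
    then show ?thesis
      using valid gf by (simp add: answer_at_view valid_config_def)
  qed
  ultimately show thesis using that N(3) by blast
qed

section \<open>Time and space bounds\<close>

lemma cells_used_le: "cells_used M xs t \<le> tape_count M * (t + 1)"
proof -
  let ?f = "\<lambda>(i, t'). (i, snd (snd (config_at M xs t') ! i))"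
  have "{(i, snd (snd (config_at M xs t') ! i)) | i t'. i < tape_count M \<and> t' \<le> t}
      = ?f ` ({..<tape_count M} \<times> {..t})"
    by auto
  then have "cells_used M xs t = card (?f ` ({..<tape_count M} \<times> {..t}))"
    by (simp add: cells_used_def)
  also have "\<dots> \<le> card ({..<tape_count M} \<times> {..t})"
    by (rule card_image_le) simp
  finally show ?thesis by simp
qed

text \<open>A machine scans at most one new cell per tape and step, so a time bound is also a space bound.\<close>

lemma poly_time_space_solvesI:
  assumes "wf_tm M" "\<And>x. x \<in> X \<Longrightarrow> Input ` set (enc x) \<subseteq> alphabet M"
    and "\<And>x. x \<in> X \<Longrightarrow> \<exists>v. answer_at M (enc x) (poly p (length (enc x))) = Some v \<and> correct x v"
  shows "poly_time_space_solves M X enc correct"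
  unfolding poly_time_space_solves_def
proof (intro conjI)
  have "cells_used M (enc x) (poly p (length (enc x)))
      \<le> poly (smult (tape_count M) (p + 1)) (length (enc x))" for x
    using cells_used_le[of M "enc x"] by simp
  then show "\<exists>p q. \<forall>x\<in>X.
      (\<exists>v. answer_at M (enc x) (poly p (length (enc x))) = Some v \<and> correct x v) \<and>
      cells_used M (enc x) (poly p (length (enc x))) \<le> poly q (length (enc x))"
    using assms(3) by blast
qed (use assms in auto)

text \<open>Coefficients in the naturals are never negative. This lets a time bound at the exact
  length of a query be replaced by one at an estimate of that length.\<close>

lemma poly_nat_mono: "m \<le> n \<Longrightarrow> poly p m \<le> poly p (n :: nat)"
  by (induction p) (auto intro!: add_mono mult_mono)

text \<open>An upper bound on the time, rather than the exact time, lets the costs of phases be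
  added and rounded up freely.\<close>

definition reaches :: "('c \<Rightarrow> 'c) \<Rightarrow> nat \<Rightarrow> 'c \<Rightarrow> 'c \<Rightarrow> bool" where
  "reaches f T c d \<longleftrightarrow> (\<exists>t\<le>T. (f ^^ t) c = d)"

lemma reaches_trans: "reaches f T c d \<Longrightarrow> reaches f U d e \<Longrightarrow> T + U \<le> W \<Longrightarrow> reaches f W c e"
proof -
  assume "reaches f T c d" "reaches f U d e" "T + U \<le> W"
  then obtain s t where "s \<le> T" "t \<le> U" "(f ^^ s) c = d" "(f ^^ t) d = e"
    by (auto simp: reaches_def)
  then have "(f ^^ (t + s)) c = e" "t + s \<le> W"
    using \<open>T + U \<le> W\<close> by (auto simp: funpow_add)
  then show ?thesis by (auto simp: reaches_def)
qed

lemma reaches_step: "reaches f T (f c) d \<Longrightarrow> Suc T \<le> W \<Longrightarrow> reaches f W c d"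
  by (rule reaches_trans[of f 1 c "f c" T]) (auto simp: reaches_def intro: exI[of _ 1])

lemma reaches_refl: "reaches f T c c"
  by (auto simp: reaches_def intro: exI[of _ 0])

lemma reaches_mono: "reaches f T c d \<Longrightarrow> T \<le> U \<Longrightarrow> reaches f U c d"
  unfolding reaches_def using le_trans by blast

section \<open>Binary counters\<close>

fun increment :: "bool list \<Rightarrow> bool list" where
  "increment [] = [True]"
| "increment (False # ds) = True # ds"
| "increment (True # ds) = False # increment ds"

lemma increment_binary_digits: "increment (binary_digits n) = binary_digits (Suc n)"
proof (induction n rule: less_induct)
  case (less n)
  show ?case
  proof (cases "n = 0")
    case True
    then show ?thesis by (simp add: binary_digits.simps[of 0] binary_digits.simps[of "Suc 0"])
  next
    case False
    then have "increment (binary_digits (n div 2)) = binary_digits (Suc (n div 2))"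
      by (intro less) auto
    then show ?thesis
      using False
      by (cases "even n") (simp_all add: binary_digits.simps[of n] binary_digits.simps[of "Suc n"])
  qed
qed

text \<open>A linear bound in place of the logarithm keeps everything polynomial, since the number
  counted is at most the length of the input.\<close>

lemma length_binary_digits: "length (binary_digits n) \<le> n"
proof (induction n rule: less_induct)
  case (less n)
  show ?case
  proof (cases "n = 0")
    case False
    then have "length (binary_digits (n div 2)) \<le> n div 2" by (intro less) auto
    then show ?thesis using False by (simp add: binary_digits.simps[of n])
  qed (simp add: binary_digits.simps)
qed

section \<open>Geodesic length after appending a generator\<close>

lemma word_value_append:
  assumes "group G" "S \<subseteq> carrier G" "v \<in> words S" "w \<in> words S"
  shows "word_value G (v @ w) = word_value G v \<otimes>\<^bsub>G\<^esub> word_value G w"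
    and "word_value G v \<in> carrier G"
proof -
  interpret group G by fact
  have closed: "word_value G w \<in> carrier G" if "w \<in> words S" for w
    using that
  proof (induction w)
    case (Cons l w)
    then have "letter_value G l \<in> carrier G" "word_value G w \<in> carrier G"
      using assms(2) by (auto simp: letter_value_def words_def)
    then show ?case by (simp add: word_value_def)
  qed (simp add: word_value_def)
  show "word_value G v \<in> carrier G" using closed assms(3) .
  show "word_value G (v @ w) = word_value G v \<otimes>\<^bsub>G\<^esub> word_value G w"
    using assms(3)
  proof (induction v)
    case Nil
    then show ?case using closed[OF assms(4)] by (simp add: word_value_def)
  next
    case (Cons l v)
    then have "letter_value G l \<in> carrier G" "word_value G v \<in> carrier G"
      using assms(2) closed by (auto simp: letter_value_def words_def)
    with Cons show ?case using closed[OF assms(4)] by (simp add: word_value_def words_def m_assoc)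
  qed
qed

text \<open>\<open>geodesic_length\<close> uses Hilbert choice, so nothing is known about it before
  a geodesic representative exists. One does, because \<open>w\<close> represents itself and lengths
  are well-founded.\<close>

lemma geodesic_length_witness:
  assumes "w \<in> words S"
  obtains v where "v \<in> words S" "word_value G v = word_value G w" "length v = geodesic_length G S w"
    "\<And>v'. v' \<in> words S \<Longrightarrow> word_value G v' = word_value G w \<Longrightarrow> geodesic_length G S w \<le> length v'"
proof -
  let ?P = "\<lambda>v. v \<in> words S \<and> word_value G v = word_value G w"
  have "\<exists>v. geodesic_rep G S w v"
    unfolding geodesic_rep_def using arg_min_natI[of ?P w length] arg_min_nat_le[of ?P _ length] assms
    by (intro exI[of _ "arg_min length ?P"]) (auto simp: is_arg_min_def not_less)
  then have "geodesic_rep G S w (SOME v. geodesic_rep G S w v)" by (rule someI_ex)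
  then show thesis
    by (intro that[of "SOME v. geodesic_rep G S w v"])
      (auto simp: geodesic_rep_def is_arg_min_def geodesic_length_def not_less)
qed

text \<open>The word \<open>u @ [(x, True)]\<close> is one of its own representatives; conversely,
  appending the inverse of \<open>x\<close> to a geodesic representative of it gives a
  representative of \<open>u\<close>.\<close>

lemma geodesic_length_snoc:
  assumes "group G" "S \<subseteq> carrier G" "geodesic_word G S u" "x \<in> S"
  shows "geodesic_length G S (u @ [(x, True)]) \<le> Suc (length u)"
    and "length u \<le> Suc (geodesic_length G S (u @ [(x, True)]))"
proof -
  interpret group G by fact
  let ?w = "u @ [(x, True)]"
  have u: "u \<in> words S" "length u = geodesic_length G S u"
    using assms(3) by (auto simp: geodesic_word_def)
  have w: "?w \<in> words S" and x: "[(x, b)] \<in> words S" for b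
    using u assms(4) by (auto simp: words_def)
  obtain v where v: "v \<in> words S" "word_value G v = word_value G ?w"
      "length v = geodesic_length G S ?w"
    and min: "\<And>v'. v' \<in> words S \<Longrightarrow> word_value G v' = word_value G ?w \<Longrightarrow>
      geodesic_length G S ?w \<le> length v'"
    using geodesic_length_witness[OF w, of G] by metis
  show "geodesic_length G S ?w \<le> Suc (length u)" using min[OF w] by simp
  have "word_value G (v @ [(x, False)])
      = (word_value G u \<otimes>\<^bsub>G\<^esub> word_value G [(x, True)]) \<otimes>\<^bsub>G\<^esub> word_value G [(x, False)]"
    using word_value_append(1)[OF assms(1,2)] u v x by metis
  also have "\<dots> = word_value G u"
  proof -
    have "x \<in> carrier G" using assms(2,4) by blast
    then show ?thesis
      using word_value_append(2)[OF assms(1,2) u(1) u(1)]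
      by (simp add: word_value_def letter_value_def m_assoc)
  qed
  finally have "word_value G (v @ [(x, False)]) = word_value G u" .
  moreover have "v @ [(x, False)] \<in> words S" using v(1) x by (auto simp: words_def)
  ultimately have "geodesic_length G S u \<le> length (v @ [(x, False)])"
    by (metis geodesic_length_witness u(1))
  then show "length u \<le> Suc (geodesic_length G S ?w)" using u(2) v(3) by simp
qed

section \<open>The comparison machine\<close>

datatype control =
  First | Single | Count | Carry bool | Return bool | Rewind | Copy | Run nat nat | Stop int

type_synonym 'a action = "'a input_symbol symbol \<times> move"

abbreviation digits :: "bool list \<Rightarrow> 'a input_symbol symbol list" where
  "digits ds \<equiv> map (\<lambda>d. Input (Bit d)) ds"

abbreviation letters :: "'a letter list \<Rightarrow> 'a input_symbol symbol list" where
  "letters w \<equiv> map (\<lambda>l. Input (Letter l)) w"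

text \<open>
  The arguments of \<open>prepare\<close> are the symbols read on the input tape and on the first tapes of the
  two copies of \<open>M\<close>. The first letter of \<open>u\<close> is not counted, so that both copies hold \<open>length u - 1\<close>
  when the separator is reached; then \<open>Carry True\<close> increments the counter of the first copy only.
  A counter has its least significant digit on the right, as \<open>encode_int\<close> demands, and the string
  \<open>u @ [x]\<close> is written from right to left in front of it.
\<close>

fun prepare :: "('a \<Rightarrow> bool) \<Rightarrow> control \<Rightarrow> 'a input_symbol symbol \<Rightarrow> 'a input_symbol symbol
    \<Rightarrow> 'a input_symbol symbol \<Rightarrow> control \<times> 'a action \<times> 'a action \<times> 'a action" where
  "prepare trivial First s a b =
     (if s = Input Sep then Single else Count, (s, Right), (a, Stay), (b, Stay))"
| "prepare trivial Single s a b =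
     (Stop (if \<exists>x c. s = Input (Letter (x, c)) \<and> trivial x then 0 else 1),
      (s, Stay), (a, Stay), (b, Stay))"
| "prepare trivial Count s a b =
     (Carry (s = Input Sep), (s, Right), (a, Left), (b, if s = Input Sep then Stay else Left))"
| "prepare trivial (Carry final) s a b =
     (let e = if a = Input (Bit True) then (Input (Bit False), Left) else (Input (Bit True), Right)
      in (if a = Input (Bit True) then Carry final else Return final,
          (s, Stay), e, if final then (b, Stay) else e))"
| "prepare trivial (Return final) s a b =
     (if a \<noteq> Blank then (Return final, (s, Stay), (a, Right), (b, if final then Stay else Right))
      else if final then (Rewind, (s, Stay), (a, Left), (b, Left))
      else (Count, (s, Stay), (a, Stay), (b, Stay)))"
| "prepare trivial Rewind s a b =
     (if a = Blank \<and> b = Blank then (Copy, (s, Stay), (Input Sep, Left), (Input Sep, Left))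
      else (Rewind, (s, Stay),
        (a, if a = Blank then Stay else Left), (b, if b = Blank then Stay else Left)))"
| "prepare trivial Copy s a b =
     (if s = Blank then (Run 0 0, (s, Stay), (a, Right), (b, Right))
      else if s = Input Sep then (Copy, (s, Left), (a, Stay), (b, Stay))
      else (Copy, (s, Left), (s, Left), (s, Left)))"
| "prepare trivial q s a b = (q, (s, Stay), (a, Stay), (b, Stay))"

text \<open>The new machine keeps the alphabet of \<open>M\<close>, so all symbols it writes must
  occur there. \<open>trivial\<close> can be any predicate: a table on a finite alphabet is merely a
  function and need not be computed.\<close>

locale comparison =
  fixes M :: "('a input_symbol, bool) tm" and trivial :: "'a \<Rightarrow> bool"
  assumes wf: "wf_tm M"
    and digits_in_alphabet: "Input (Bit d) \<in> alphabet M" and Sep_in_alphabet: "Input Sep \<in> alphabet M"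
begin

abbreviation "k \<equiv> tape_count M"

text \<open>\<open>delta M\<close> carries no guarantee in halting states, so a halted copy rewrites
  the symbols it reads and stays.\<close>

definition run_copy :: "nat \<Rightarrow> 'a input_symbol symbol list \<Rightarrow> nat \<times> 'a action list" where
  "run_copy i ss = (if verdict M i = None then delta M i ss else (i, map (\<lambda>s. (s, Stay)) ss))"

fun transition :: "control \<Rightarrow> 'a input_symbol symbol list \<Rightarrow> control \<times> 'a action list" where
  "transition (Run i j) ss =
     (case (run_copy i (take k (tl ss)), run_copy j (drop k (tl ss))) of
        ((i', as), (j', bs)) \<Rightarrow> (Run i' j', (hd ss, Stay) # as @ bs))"
| "transition q ss =
     (case prepare trivial q (ss ! 0) (ss ! 1) (ss ! (k + 1)) of
        (q', a0, a, b) \<Rightarrow>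
          (q', a0 # (a # replicate (k - 1) (Blank, Stay)) @ b # replicate (k - 1) (Blank, Stay)))"

text \<open>\<open>i\<close> answers the query about the length of \<open>u\<close>,
  \<open>j\<close> the one about that length minus 1. A positive second answer entails the first, so
  it is tested first.\<close>

fun result :: "control \<Rightarrow> int option" where
  "result (Run i j) = (case (verdict M i, verdict M j) of
     (Some b, Some c) \<Rightarrow> Some (if c then - 1 else if b then 0 else 1) | _ \<Rightarrow> None)"
| "result (Stop d) = Some d"
| "result _ = None"

definition controls :: "control set" where
  "controls = {First, Single, Count, Rewind, Copy} \<union> range Carry \<union> range Return \<union> Stop ` {0, 1}
     \<union> (\<lambda>(i, j). Run i j) ` ({..<state_count M} \<times> {..<state_count M})"

lemma controls_simps [simp]:
  "First \<in> controls" "Single \<in> controls" "Count \<in> controls" "Carry final \<in> controls"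
  "Return final \<in> controls" "Rewind \<in> controls" "Copy \<in> controls"
  "Stop d \<in> controls \<longleftrightarrow> d \<in> {0, 1}"
  "Run i j \<in> controls \<longleftrightarrow> i < state_count M \<and> j < state_count M"
  by (auto simp: controls_def)

lemma finite_controls: "finite controls"
  by (simp add: controls_def)

lemma tape_count_pos: "0 < k"
  using wf by (simp add: wf_tm_def)

lemma run_copy_closed:
  assumes "i < state_count M" "length ss = k" "set ss \<subseteq> alphabet M" "run_copy i ss = (i', as)"
  shows "i' < state_count M" "length as = k" "fst ` set as \<subseteq> alphabet M"
  using assms wf unfolding wf_tm_def run_copy_def by (auto split: if_splits) fastforce+

lemma prepare_closed:
  assumes "prepare trivial q s a b = (q', e0, e1, e2)" "q \<in> controls" "\<nexists>i j. q = Run i j"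
    and "{s, a, b} \<subseteq> alphabet M"
  shows "q' \<in> controls \<and> {fst e0, fst e1, fst e2} \<subseteq> alphabet M"
proof -
  have "0 < state_count M" using wf by (simp add: wf_tm_def)
  with assms digits_in_alphabet Sep_in_alphabet show ?thesis
    by (cases q) (simp_all add: Let_def split: if_splits, auto)
qed

lemma transition_closed: "closed_table controls (alphabet M) (Suc (2 * k)) transition result"
  unfolding closed_table_def
proof (intro ballI allI impI)
  fix q ss
  assume q: "q \<in> controls"
    and ss: "result q = None \<and> length ss = Suc (2 * k) \<and> set ss \<subseteq> alphabet M"
  let ?P = "case transition q ss of (q', as) \<Rightarrow>
    q' \<in> controls \<and> length as = Suc (2 * k) \<and> fst ` set as \<subseteq> alphabet M"
  show ?P
  proof (cases "\<exists>i j. q = Run i j")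
    case True
    then obtain i j where [simp]: "q = Run i j" by blast
    obtain i' as where r1: "run_copy i (take k (tl ss)) = (i', as)" by (rule prod.exhaust)
    obtain j' bs where r2: "run_copy j (drop k (tl ss)) = (j', bs)" by (rule prod.exhaust)
    have hd: "hd ss \<in> alphabet M" and tl: "set (tl ss) \<subseteq> alphabet M"
      using ss by (cases ss; simp)+
    have sub: "set (take k (tl ss)) \<subseteq> alphabet M" "set (drop k (tl ss)) \<subseteq> alphabet M"
      using tl by (auto dest: in_set_takeD in_set_dropD)
    have len: "length (take k (tl ss)) = k" "length (drop k (tl ss)) = k"
      using ss by simp_all
    have ij: "i < state_count M" "j < state_count M" using q by auto
    note copies = run_copy_closed[OF ij(1) len(1) sub(1) r1] run_copy_closed[OF ij(2) len(2) sub(2) r2]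
    have "transition q ss = (Run i' j', (hd ss, Stay) # as @ bs)"
      using r1 r2 by simp
    moreover have "length ((hd ss, Stay) # as @ bs) = Suc (2 * k)" using copies by simp
    moreover have "fst ` set ((hd ss, Stay) # as @ bs) \<subseteq> alphabet M"
      using copies hd by (simp add: image_Un)
    ultimately show ?thesis using copies by simp
  next
    case False
    obtain q' e0 e1 e2 where e: "prepare trivial q (ss ! 0) (ss ! 1) (ss ! (k + 1)) = (q', e0, e1, e2)"
      by (rule prod_cases4)
    have "ss ! i \<in> alphabet M" if "i < Suc (2 * k)" for i
      using nth_mem[of i ss] ss that by (simp add: subset_iff)
    then have "{ss ! 0, ss ! 1, ss ! (k + 1)} \<subseteq> alphabet M"
      using tape_count_pos by simp
    then have "q' \<in> controls \<and> {fst e0, fst e1, fst e2} \<subseteq> alphabet M"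
      using prepare_closed[OF e q] False by blast
    moreover have "transition q ss =
        (q', e0 # (e1 # replicate (k - 1) (Blank, Stay)) @ e2 # replicate (k - 1) (Blank, Stay))"
      using e False by (cases q) auto
    moreover have "Blank \<in> alphabet M" using wf by (simp add: wf_tm_def)
    ultimately show ?thesis using tape_count_pos by auto
  qed
qed

section \<open>Correctness of the preparation\<close>

abbreviation "copy_step \<equiv> view_step (delta M) (verdict M)"

abbreviation "machine_step \<equiv> view_step transition result"

definition blanks :: "'a input_symbol view list" where
  "blanks = replicate (k - 1) (zipper [] [])"

definition conf :: "control \<Rightarrow> 'a input_symbol view \<Rightarrow> 'a input_symbol view \<Rightarrow> 'a input_symbol view
    \<Rightarrow> control \<times> 'a input_symbol view list" where
  "conf q v a b = (q, v # (a # blanks) @ b # blanks)"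

lemma machine_step_conf:
  assumes "result q = None" "\<nexists>i j. q = Run i j"
    and "prepare trivial q (v 0) (a 0) (b 0) = (q', e0, e1, e2)"
  shows "machine_step (conf q v a b) = conf q' (view_act e0 v) (view_act e1 a) (view_act e2 b)"
proof -
  let ?r = "replicate (k - 1) (Blank, Stay)"
  have "map (\<lambda>v. v 0) (v # (a # blanks) @ b # blanks) ! (k + 1) = b 0"
    using tape_count_pos by (simp add: blanks_def nth_append)
  then have "transition q (map (\<lambda>v. v 0) (v # (a # blanks) @ b # blanks))
      = (q', e0 # (e1 # ?r) @ e2 # ?r)"
    using assms by (cases q) simp_all
  moreover have "map2 view_act ?r blanks = blanks"
    by (simp add: blanks_def zip_replicate)
  then have "map2 view_act (e0 # (e1 # ?r) @ e2 # ?r) (v # (a # blanks) @ b # blanks)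
      = view_act e0 v # (view_act e1 a # blanks) @ view_act e2 b # blanks"
    by (simp add: blanks_def)
  ultimately show ?thesis
    unfolding view_step_def conf_def prod.case using assms(1) by (simp only: prod.case) simp
qed

text \<open>Symbolic execution: each backward application performs one machine step, and the
  \<open>case\<close> form leaves the evaluation of \<open>prepare\<close> to the
  simplifier.\<close>

lemma reaches_conf:
  assumes "result q = None" "\<nexists>i j. q = Run i j" "0 < T"
    and "case prepare trivial q (v 0) (a 0) (b 0) of (q', e0, e1, e2) \<Rightarrow>
      reaches machine_step (T - 1) (conf q' (view_act e0 v) (view_act e1 a) (view_act e2 b)) d"
  shows "reaches machine_step T (conf q v a b) d"
proof -
  obtain q' e0 e1 e2 where e: "prepare trivial q (v 0) (a 0) (b 0) = (q', e0, e1, e2)"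
    by (rule prod_cases4)
  have "reaches machine_step (T - 1) (machine_step (conf q v a b)) d"
    unfolding machine_step_conf[of q v a b, OF assms(1,2) e]
    using assms(4) unfolding e prod.case .
  moreover have "Suc (T - 1) \<le> T" using assms(3) by simp
  ultimately show ?thesis by (rule reaches_step)
qed

text \<open>The conditional covers both modes: either the second copy rests on \<open>b\<close>, or
  it equals the first, so that the symbols read on the first copy may steer both.\<close>

lemma Return_loop:
  assumes "Blank \<notin> set zs"
  shows "reaches machine_step (length zs)
     (conf (Return final) v (zipper xs zs) (if final then b else zipper xs zs))
     (conf (Return final) v (zipper (rev zs @ xs) []) (if final then b else zipper (rev zs @ xs) []))"
  using assms
proof (induction zs arbitrary: xs)
  case (Cons z zs)
  show ?case
    by (rule reaches_conf) (use Cons.IH[of "z # xs"] Cons.prems in \<open>cases final; auto\<close>)+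
qed (simp add: reaches_refl)

text \<open>\<open>ds\<close> lists the digits from the head leftwards, \<open>zs\<close> those
  already passed. Leading ones of \<open>ds\<close> become zeros and the next zero or blank becomes
  a one; the head then returns over all it has passed, whence the factor 2.\<close>

lemma Carry_loop:
  fixes ds zs :: "bool list"
  defines "a \<equiv> zipper (tl (digits ds)) (head_symbol (digits ds) # digits zs)"
    and "a' \<equiv> zipper (digits (rev zs @ increment ds)) []"
  shows "reaches machine_step (2 * length ds + length zs + 1)
     (conf (Carry final) v a (if final then b else a))
     (conf (Return final) v a' (if final then b else a'))"
  unfolding a_def a'_def
proof (induction ds arbitrary: zs rule: increment.induct)
  case 1
  have "Blank \<notin> set (digits zs)" by auto
  from Return_loop[OF this, of final v "digits [True]" b] show ?case
    by (intro reaches_conf) (cases final; simp add: rev_map Let_def)+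
next
  case (2 ds)
  have "Blank \<notin> set (digits zs)" by auto
  from Return_loop[OF this, of final v "digits (True # ds)" b] show ?case
    by (intro reaches_conf)
      (cases final; simp add: rev_map Let_def; (erule reaches_mono; simp)?)+
next
  case (3 ds)
  from 3[of "False # zs"] show ?case
    by (intro reaches_conf) (cases final; simp add: Let_def)+
qed

text \<open>The head rests on the blank to the right of the least significant digit.\<close>

abbreviation counter :: "nat \<Rightarrow> 'a input_symbol view" where
  "counter n \<equiv> zipper (digits (binary_digits n)) []"

lemma counter_increment:
  fixes m :: nat
  defines "ds \<equiv> digits (binary_digits m)"
  defines "a \<equiv> zipper (tl ds) [head_symbol ds]"
  shows "reaches machine_step (2 * m + 1)
     (conf (Carry final) v a (if final then b else a))
     (conf (Return final) v (counter (Suc m)) (if final then b else counter (Suc m)))"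
  using Carry_loop[of "binary_digits m" "[]" final v b] length_binary_digits[of m]
  unfolding a_def ds_def
  by (auto simp: increment_binary_digits elim!: reaches_mono)

text \<open>One step reads the letter, \<open>2 * m + 1\<close> increment the counters, and one
  leaves \<open>Return\<close>.\<close>

lemma Count_letter:
  "reaches machine_step (2 * m + 3)
     (conf Count (zipper xs (Input (Letter l) # ys)) (counter m) (counter m))
     (conf Count (zipper (Input (Letter l) # xs) ys) (counter (Suc m)) (counter (Suc m)))"
proof (rule reaches_conf)
  let ?v = "zipper (Input (Letter l) # xs) ys"
  have "reaches machine_step 1 (conf (Return False) ?v (counter (Suc m)) (counter (Suc m)))
      (conf Count ?v (counter (Suc m)) (counter (Suc m)))"
    by (rule reaches_conf) (simp_all add: reaches_refl)
  with counter_increment[of m False ?v]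
  have "reaches machine_step (2 * m + 2)
      (conf (Carry False) ?v
        (zipper (tl (digits (binary_digits m))) [head_symbol (digits (binary_digits m))])
        (zipper (tl (digits (binary_digits m))) [head_symbol (digits (binary_digits m))]))
      (conf Count ?v (counter (Suc m)) (counter (Suc m)))"
    by (auto elim: reaches_trans)
  then show "case prepare trivial Count (zipper xs (Input (Letter l) # ys) 0) (counter m 0) (counter m 0)
      of (q', e0, e1, e2) \<Rightarrow> reaches machine_step (2 * m + 3 - 1)
        (conf q' (view_act e0 (zipper xs (Input (Letter l) # ys)))
          (view_act e1 (counter m)) (view_act e2 (counter m)))
        (conf Count ?v (counter (Suc m)) (counter (Suc m)))"
    by simp
qed simp_all

text \<open>Every letter is charged the cost at the final counter value, which makes counting
  quadratic.\<close>

lemma Count_loop: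
  "reaches machine_step (length w * (2 * (m + length w) + 3))
     (conf Count (zipper xs (letters w @ ys)) (counter m) (counter m))
     (conf Count (zipper (rev (letters w) @ xs) ys) (counter (m + length w)) (counter (m + length w)))"
proof (induction w arbitrary: m xs)
  case (Cons l w)
  show ?case
    using reaches_mono[OF reaches_trans[OF Count_letter[where m = m and xs = xs and l = l]
        Cons.IH[where m = "Suc m"] order_refl], of "length (l # w) * (2 * (m + length (l # w)) + 3)"]
    by (simp add: algebra_simps)
qed (simp add: reaches_refl)

text \<open>This is where the two queries become different: the second counter waits while the first
  is incremented.\<close>

lemma Count_final:
  "reaches machine_step (2 * m + 3)
     (conf Count (zipper xs [Input Sep, y]) (counter m) (counter m))
     (conf Rewind (zipper (Input Sep # xs) [y])
        (zipper (tl (digits (binary_digits (Suc m)))) [head_symbol (digits (binary_digits (Suc m)))])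
        (zipper (tl (digits (binary_digits m))) [head_symbol (digits (binary_digits m))]))"
  (is "reaches _ _ _ ?d")
proof (rule reaches_conf)
  let ?v = "zipper (Input Sep # xs) [y]"
  have "reaches machine_step 1 (conf (Return True) ?v (counter (Suc m)) (counter m)) ?d"
    by (rule reaches_conf) (simp_all add: reaches_refl)
  with counter_increment[of m True ?v "counter m"]
  have "reaches machine_step (2 * m + 2)
      (conf (Carry True) ?v
        (zipper (tl (digits (binary_digits m))) [head_symbol (digits (binary_digits m))])
        (counter m)) ?d"
    by (auto elim: reaches_trans)
  then show "case prepare trivial Count (zipper xs [Input Sep, y] 0) (counter m 0) (counter m 0)
      of (q', e0, e1, e2) \<Rightarrow> reaches machine_step (2 * m + 3 - 1)
        (conf q' (view_act e0 (zipper xs [Input Sep, y]))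
          (view_act e1 (counter m)) (view_act e2 (counter m))) ?d"
    by simp
qed simp_all

text \<open>The counters differ in length when the larger value is a power of 2, so the head that
  reaches its blank first waits. Every step before the last shortens at least one list, hence
  induction on the sum of the lengths.\<close>

lemma Rewind_loop:
  assumes "Blank \<notin> set xs" "Blank \<notin> set ys"
  shows "reaches machine_step (length xs + length ys + 1)
     (conf Rewind v (zipper (tl xs) (head_symbol xs # ra)) (zipper (tl ys) (head_symbol ys # rb)))
     (conf Copy v (zipper [] (Blank # Input Sep # rev xs @ ra))
       (zipper [] (Blank # Input Sep # rev ys @ rb)))"
  using assms
proof (induction "length xs + length ys" arbitrary: xs ys ra rb rule: less_induct)
  case less
  show ?case
  proof (cases xs)
    case xs: Nil
    show ?thesis
    proof (cases ys)
      case Nil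
      with xs show ?thesis by (intro reaches_conf) (simp_all add: reaches_refl)
    next
      case (Cons y ys')
      with xs less.prems less.hyps[of xs ys' ra "y # rb"] show ?thesis
        by (intro reaches_conf) auto
    qed
  next
    case xs: (Cons x xs')
    show ?thesis
    proof (cases ys)
      case Nil
      with xs less.prems less.hyps[of xs' ys "x # ra" rb] show ?thesis
        by (intro reaches_conf) auto
    next
      case (Cons y ys')
      with xs less.prems less.hyps[of xs' ys' "x # ra" "y # rb"] show ?thesis
        by (intro reaches_conf) (auto elim!: reaches_mono)
    qed
  qed
qed

text \<open>\<open>xs\<close> is the rest of the input in the order in which it is read, from right
  to left. The blank before the input ends the loop, and the final move to the right puts the heads
  on the first symbol written.\<close>

lemma Copy_loop:
  assumes "Blank \<notin> set xs"
  shows "reaches machine_step (length xs + 1)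
     (conf Copy (zipper (tl xs) (head_symbol xs # zs)) (zipper [] (Blank # ra)) (zipper [] (Blank # rb)))
     (conf (Run 0 0) (zipper [] (Blank # rev xs @ zs))
        (zipper [] (rev (filter (\<lambda>s. s \<noteq> Input Sep) xs) @ ra))
        (zipper [] (rev (filter (\<lambda>s. s \<noteq> Input Sep) xs) @ rb)))"
  using assms
proof (induction xs arbitrary: zs ra rb)
  case Nil
  show ?case by (rule reaches_conf) (simp_all add: reaches_refl)
next
  case (Cons s xs)
  show ?case
  proof (cases "s = Input Sep")
    case True
    with Cons.IH[of "s # zs" ra rb] Cons.prems show ?thesis by (intro reaches_conf) auto
  next
    case False
    with Cons.IH[of "s # zs" "s # ra" "s # rb"] Cons.prems show ?thesis
      by (intro reaches_conf) auto
  qed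
qed

lemma start_conf:
  "(First, start_views (Suc (2 * k)) (encode_word_gen (u, x)))
     = conf First (zipper [] (letters u @ [Input Sep, Input (Letter (x, True))]))
         (zipper [] []) (zipper [] [])"
proof -
  have "replicate (2 * k) z = (z # replicate (k - 1) z) @ z # replicate (k - 1) z"
    for z :: "'a input_symbol view"
  proof -
    have "replicate k z = z # replicate (k - 1) z"
      using tape_count_pos by (cases k) simp_all
    then show ?thesis by (metis mult_2 replicate_add)
  qed
  then show ?thesis
    by (simp add: conf_def blanks_def start_views_def encode_word_gen_def comp_def)
qed

lemma preparation:
  fixes l :: "'a letter" and w :: "'a letter list" and x :: 'a
  defines "n \<equiv> Suc (length w)" and "ux \<equiv> (l # w) @ [(x, True)]"
  shows "\<exists>v. reaches machine_step (2 * n ^ 2 + 10 * n + 10)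
     (First, start_views (Suc (2 * k)) (encode_word_gen (l # w, x)))
     (Run 0 0, v # start_views k (encode_word_int (ux, int n))
        @ start_views k (encode_word_int (ux, int n - 1)))"
proof -
  let ?y = "Input (Letter (x, True))"
  let ?xs = "rev (letters (l # w))"
  let ?X = "?y # Input Sep # ?xs"
  let ?d = "\<lambda>m. digits (binary_digits m)"
  let ?R = "\<lambda>m. letters ux @ Input Sep # rev (?d m)"
  let ?m = "length w"
  \<comment> \<open>\<open>encode_int\<close> writes no sign for a nonnegative number, so
    \<open>?R m\<close> is exactly an encoded instance. For the second query this uses that
    \<open>int n - 1\<close> is \<open>int ?m\<close>.\<close>
  have enc: "zipper [] (?R m) # blanks = start_views k (encode_word_int (ux, int m))" for m
    by (simp add: start_views_def blanks_def encode_word_int_def encode_int_def rev_map comp_def)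
  have "(First, start_views (Suc (2 * k)) (encode_word_gen (l # w, x)))
      = conf First (zipper [] (letters (l # w) @ [Input Sep, ?y])) (zipper [] []) (zipper [] [])"
    by (rule start_conf)
  moreover have count_first: "reaches machine_step 1
      (conf First (zipper [] (letters (l # w) @ [Input Sep, ?y])) (zipper [] []) (zipper [] []))
      (conf Count (zipper [Input (Letter l)] (letters w @ [Input Sep, ?y])) (counter 0) (counter 0))"
    by (rule reaches_conf) (simp_all add: reaches_refl binary_digits.simps)
  have count: "reaches machine_step (?m * (2 * ?m + 3))
      (conf Count (zipper [Input (Letter l)] (letters w @ [Input Sep, ?y])) (counter 0) (counter 0))
      (conf Count (zipper ?xs [Input Sep, ?y]) (counter ?m) (counter ?m))"
    using Count_loop[of w 0 "[Input (Letter l)]" "[Input Sep, ?y]"] by simp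
  have rewind: "reaches machine_step (2 * ?m + 2)
     (conf Rewind (zipper (Input Sep # ?xs) [?y])
        (zipper (tl (?d n)) [head_symbol (?d n)]) (zipper (tl (?d ?m)) [head_symbol (?d ?m)]))
     (conf Copy (zipper (tl ?X) [head_symbol ?X])
        (zipper [] (Blank # Input Sep # rev (?d n))) (zipper [] (Blank # Input Sep # rev (?d ?m))))"
  proof -
    have "Blank \<notin> set (?d i)" for i by auto
    from Rewind_loop[OF this this, of n ?m "zipper (Input Sep # ?xs) [?y]" "[]" "[]"]
    have "reaches machine_step (length (?d n) + length (?d ?m) + 1)
     (conf Rewind (zipper (Input Sep # ?xs) [?y])
        (zipper (tl (?d n)) [head_symbol (?d n)]) (zipper (tl (?d ?m)) [head_symbol (?d ?m)]))
     (conf Copy (zipper (tl ?X) [head_symbol ?X])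
        (zipper [] (Blank # Input Sep # rev (?d n))) (zipper [] (Blank # Input Sep # rev (?d ?m))))"
      by simp
    then show ?thesis
      by (rule reaches_mono)
        (use length_binary_digits[of n] length_binary_digits[of ?m] in \<open>simp add: n_def\<close>)
  qed
  have copy: "reaches machine_step (?m + 4)
     (conf Copy (zipper (tl ?X) [head_symbol ?X])
        (zipper [] (Blank # Input Sep # rev (?d n))) (zipper [] (Blank # Input Sep # rev (?d ?m))))
     (conf (Run 0 0) (zipper [] (Blank # rev ?X)) (zipper [] (?R n)) (zipper [] (?R ?m)))"
  proof -
    have "Blank \<notin> set ?X" by auto
    moreover have "rev (filter (\<lambda>s. s \<noteq> Input Sep) ?X) = letters ux"
      by (simp add: ux_def rev_filter[symmetric] filter_map comp_def)
    ultimately show ?thesis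
      using Copy_loop[of ?X "[]" "Input Sep # rev (?d n)" "Input Sep # rev (?d ?m)"]
      by (simp add: eval_nat_numeral)
  qed
  \<comment> \<open>With m = \<open>length w\<close> the five phases take at most 1, m(2m + 3), 2m +
    3, 2m + 2 and m + 4 steps, in total 2m^2 + 8m + 10; the bound in terms of \<open>n\<close> is
    coarser.\<close>
  note reaches_trans[OF count_first reaches_trans[OF count
      reaches_trans[OF Count_final reaches_trans[OF rewind[unfolded n_def] copy[unfolded n_def]
        order_refl] order_refl] order_refl] order_refl]
  ultimately have "reaches machine_step (2 * n ^ 2 + 10 * n + 10)
     (First, start_views (Suc (2 * k)) (encode_word_gen (l # w, x)))
     (conf (Run 0 0) (zipper [] (Blank # rev ?X)) (zipper [] (?R n)) (zipper [] (?R ?m)))"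
    unfolding n_def by (auto elim!: reaches_mono simp: power2_eq_square algebra_simps)
  moreover have "conf (Run 0 0) (zipper [] (Blank # rev ?X)) (zipper [] (?R n)) (zipper [] (?R ?m))
      = (Run 0 0, zipper [] (Blank # rev ?X) # start_views k (encode_word_int (ux, int n))
        @ start_views k (encode_word_int (ux, int n - 1)))"
    using enc[of n] enc[of ?m] by (simp add: conf_def n_def)
  ultimately show ?thesis by auto
qed

section \<open>Running the two copies in parallel\<close>

lemma copy_step_run_copy:
  assumes "run_copy i (map (\<lambda>v. v 0) vs) = (i', as)"
  shows "copy_step (i, vs) = (i', map2 view_act as vs)"
proof -
  have "map2 view_act (map (\<lambda>s. (s, Stay)) (map (\<lambda>v. v 0) vs)) vs = vs"
    by (induction vs) simp_all
  then show ?thesis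
    using assms by (auto simp: view_step_def run_copy_def split: if_splits)
qed

abbreviation valid_copy :: "nat \<times> 'a input_symbol view list \<Rightarrow> bool" where
  "valid_copy \<equiv> valid_config {..<state_count M} (alphabet M) k"

lemma machine_step_Run:
  assumes "valid_copy (i, vs)" "valid_copy (j, ws)"
    and "copy_step (i, vs) = (i', vs')" "copy_step (j, ws) = (j', ws')"
  shows "machine_step (Run i j, v # vs @ ws) = (Run i' j', v # vs' @ ws')"
proof -
  let ?read = "map (\<lambda>v. v 0)"
  have len: "length vs = k" "length ws = k" using assms by (simp_all add: valid_config_def)
  obtain i1 as where a: "run_copy i (?read vs) = (i1, as)" by (rule prod.exhaust)
  obtain j1 bs where b: "run_copy j (?read ws) = (j1, bs)" by (rule prod.exhaust)
  have eqs: "i' = i1" "vs' = map2 view_act as vs" "j' = j1" "ws' = map2 view_act bs ws"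
    using copy_step_run_copy[OF a] copy_step_run_copy[OF b] assms(3,4) by simp_all
  show ?thesis
  proof (cases "result (Run i j)")
    case None
    have "set (?read vs) \<subseteq> alphabet M" "i < state_count M"
      using assms(1) by (auto simp: valid_config_def)
    \<comment> \<open>Zipping \<open>as @ bs\<close> with \<open>vs @ ws\<close> must split at the
      border between the copies.\<close>
    then have "length as = k"
      using run_copy_closed(2)[OF _ _ _ a] len by simp
    then show ?thesis
      using None a b len eqs by (simp add: view_step_def)
  next
    \<comment> \<open>The pair has a verdict only if both copies have one, so both are frozen
      together with the machine.\<close>
    case (Some d)
    then have "verdict M i \<noteq> None" "verdict M j \<noteq> None" by (auto split: option.splits)
    then have "i' = i" "vs' = vs" "j' = j" "ws' = ws"
      using assms(3,4) by (simp_all add: view_step_def)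
    then show ?thesis using Some by (simp add: view_step_def del: result.simps)
  qed
qed

lemma machine_steps_Run:
  assumes "valid_copy c" "valid_copy d"
  shows "(machine_step ^^ t) (Run (fst c) (fst d), v # snd c @ snd d)
     = (Run (fst ((copy_step ^^ t) c)) (fst ((copy_step ^^ t) d)),
        v # snd ((copy_step ^^ t) c) @ snd ((copy_step ^^ t) d))"
proof (induction t)
  case (Suc t)
  let ?c = "(copy_step ^^ t) c" and ?d = "(copy_step ^^ t) d"
  have "valid_copy ?c" "valid_copy ?d"
    using assms closed_table_tm[OF wf] valid_config_steps by blast+
  then show ?case
    unfolding funpow.simps comp_apply Suc by (intro machine_step_Run) simp_all
qed simp

definition machine_answer :: "'a letter list \<times> 'a \<Rightarrow> nat \<Rightarrow> int option" where
  "machine_answer ux t =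
     result (fst ((machine_step ^^ t) (First, start_views (Suc (2 * k)) (encode_word_gen ux))))"

text \<open>\<open>T\<close> is a common time bound for both queries; once both copies have halted,
  the answer persists up to \<open>U\<close>.\<close>

lemma machine_answer_Cons:
  fixes l :: "'a letter" and w :: "'a letter list" and x :: 'a
  defines "n \<equiv> Suc (length w)" and "ux \<equiv> (l # w) @ [(x, True)]"
  assumes "Input ` set (encode_word_int (ux, int n)) \<subseteq> alphabet M"
    and "Input ` set (encode_word_int (ux, int n - 1)) \<subseteq> alphabet M"
    and "answer_at M (encode_word_int (ux, int n)) T = Some b"
    and "answer_at M (encode_word_int (ux, int n - 1)) T = Some c"
    and "2 * n ^ 2 + 10 * n + 10 + T \<le> U"
  shows "machine_answer (l # w, x) U = Some (if c then - 1 else if b then 0 else 1)"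
proof -
  let ?a = "(0 :: nat, start_views k (encode_word_int (ux, int n)))"
  let ?b = "(0 :: nat, start_views k (encode_word_int (ux, int n - 1)))"
  let ?s = "(First, start_views (Suc (2 * k)) (encode_word_gen (l # w, x)))"
  obtain v t where t: "t \<le> 2 * n ^ 2 + 10 * n + 10"
    and v: "(machine_step ^^ t) ?s = (Run (fst ?a) (fst ?b), v # snd ?a @ snd ?b)"
    using preparation[where l = l and w = w and x = x] unfolding reaches_def n_def ux_def by auto
  have "valid_copy ?a" "valid_copy ?b"
    using wf assms(3,4) by (auto intro!: valid_start simp: wf_tm_def)
  from machine_steps_Run[OF this, of T v]
  have "(machine_step ^^ (T + t)) ?s
      = (Run (fst ((copy_step ^^ T) ?a)) (fst ((copy_step ^^ T) ?b)),
         v # snd ((copy_step ^^ T) ?a) @ snd ((copy_step ^^ T) ?b))"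
    by (simp only: funpow_add comp_apply v)
  then have "result (fst ((machine_step ^^ (T + t)) ?s)) = Some (if c then - 1 else if b then 0 else 1)"
    using assms(5,6) by (simp add: answer_at_view)
  then show ?thesis
    unfolding machine_answer_def by (rule view_step_answer_mono) (use t assms(7) in simp)
qed

lemma machine_answer_Nil:
  assumes "2 \<le> U"
  shows "machine_answer ([], x) U = Some (if trivial x then 0 else 1)"
proof -
  let ?s = "(First, start_views (Suc (2 * k)) (encode_word_gen ([], x)))"
  let ?v = "zipper [Input Sep] [Input (Letter (x, True))]"
  have "reaches machine_step 2 ?s
      (conf (Stop (if trivial x then 0 else 1)) ?v (zipper [] []) (zipper [] []))"
    (is "reaches _ _ _ ?d")
  proof -
    have "reaches machine_step 1 (conf Single ?v (zipper [] []) (zipper [] [])) ?d"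
      by (rule reaches_conf) (auto simp: reaches_refl)
    then show ?thesis unfolding start_conf by (intro reaches_conf) simp_all
  qed
  then obtain t where "t \<le> 2"
    "(machine_step ^^ t) ?s = conf (Stop (if trivial x then 0 else 1)) ?v (zipper [] []) (zipper [] [])"
    unfolding reaches_def by blast
  then have "result (fst ((machine_step ^^ t) ?s)) = Some (if trivial x then 0 else 1)"
    by (simp add: conf_def)
  then show ?thesis
    unfolding machine_answer_def
    by (rule view_step_answer_mono) (use \<open>t \<le> 2\<close> assms in simp)
qed

end

section \<open>The polynomial bound and the final machine\<close>

lemma geodesic_length_Nil: "geodesic_length G S [] = 0"
proof -
  have "[] \<in> words S" by (simp add: words_def)
  then show ?thesis using geodesic_length_witness[of "[]" S G] by (metis le_zero_eq list.size(3))
qed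

lemma binary_digits_2: "binary_digits 2 = [False, True]"
  by (simp add: binary_digits.simps[of 2] binary_digits.simps[of "Suc 0"] binary_digits.simps[of 0])

lemma length_encode_nat: "length (encode_int (int n)) \<le> n"
  by (simp add: encode_int_def length_binary_digits)

theorem proposition2:
  fixes G :: "('a, 'b) monoid_scheme" and S :: "'a set"
  assumes "group G"
    and "finite S"
    and "S \<subseteq> carrier G"
    and "generate G S = carrier G"
    and "\<exists>M. bounded_geodesic_length_algorithm G S M"
  shows "\<exists>M. geodesic_extension_algorithm G S M"
proof -
  let ?L = "geodesic_length G S"
  let ?X = "{(w, j :: int). w \<in> words S}"
  obtain M where M: "bounded_geodesic_length_algorithm G S M" using assms(5) ..
  then have wf: "wf_tm M" and sub_X: "\<forall>x\<in>?X. Input ` set (encode_word_int x) \<subseteq> alphabet M"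
    unfolding bounded_geodesic_length_algorithm_def poly_time_space_solves_def by blast+
  obtain p where p: "\<forall>x\<in>?X.
      \<exists>v. answer_at M (encode_word_int x) (poly p (length (encode_word_int x))) = Some v \<and>
        (case x of (w, j) \<Rightarrow> \<lambda>b. b \<longleftrightarrow> int (?L w) \<le> j) v"
    using M unfolding bounded_geodesic_length_algorithm_def poly_time_space_solves_def by blast
  have alphabet: "Input ` set (encode_word_int (w, j)) \<subseteq> alphabet M" if "w \<in> words S" for w j
    by (rule sub_X[rule_format]) (use that in simp)
  have answer: "answer_at M (encode_word_int (w, j)) (poly p (length (encode_word_int (w, j))))
      = Some (int (?L w) \<le> j)" if "w \<in> words S" for w j
    using p[rule_format, of "(w, j)"] that by simp
  \<comment> \<open>\<open>M\<close> must admit the encodings of all instances. The number 2 is the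
    least one whose binary expansion contains both digits.\<close>
  have "{Sep, Bit True, Bit False} \<subseteq> set (encode_word_int ([] :: 'a letter list, 2))"
    by (simp add: encode_word_int_def encode_int_def binary_digits_2)
  moreover have "[] \<in> words S" by (simp add: words_def)
  ultimately have "{Input Sep, Input (Bit True), Input (Bit False)} \<subseteq> alphabet M"
    using alphabet[of "[]" 2] by auto
  then have "Input (Bit d) \<in> alphabet M" "Input Sep \<in> alphabet M" for d
    by (cases d; simp)+
  then interpret comparison M "\<lambda>x. ?L [(x, True)] = 0"
    using wf by unfold_locales
  have table: "First \<in> controls" "finite (alphabet M)" "Blank \<in> alphabet M" "0 < Suc (2 * tape_count M)"
    using wf by (simp_all add: wf_tm_def)
  obtain N where N: "wf_tm N" "alphabet N = alphabet M"
    and answer_N: "\<And>ux t. Input ` set (encode_word_gen ux) \<subseteq> alphabet M \<Longrightarrow>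
      answer_at N (encode_word_gen ux) t = machine_answer ux t"
    using tm_of_table[OF finite_controls table transition_closed] unfolding machine_answer_def by metis
  \<comment> \<open>The quadratic part bounds the preparation. The copies get time \<open>p\<close>
    at twice the input length, because each query is at most that long.\<close>
  define P where "P = [:10, 10, 2:] + pcompose p [:0, 2:]"
  have sub: "Input ` set (encode_word_gen (u, x)) \<subseteq> alphabet M" if "u \<in> words S" "x \<in> S" for u x
  proof -
    have "set (encode_word_gen (u, x)) \<subseteq> set (encode_word_int (u @ [(x, True)], 0))"
      by (auto simp: encode_word_gen_def encode_word_int_def)
    moreover have "u @ [(x, True)] \<in> words S" using that by (auto simp: words_def)
    ultimately show ?thesis using alphabet by blast
  qed
  have correct: "\<exists>d. machine_answer (u, x) (poly P (length (encode_word_gen (u, x)))) = Some d \<and>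
      d \<in> {0, 1, - 1} \<and> int (?L (u @ [(x, True)])) - int (?L u) = d"
    if u: "geodesic_word G S u" and x: "x \<in> S" for u x
  proof -
    let ?ux = "u @ [(x, True)]"
    let ?N = "length u + 2"
    have "u \<in> words S" and len: "length u = ?L u" using u by (auto simp: geodesic_word_def)
    then have ux: "?ux \<in> words S" using x by (auto simp: words_def)
    have N_eq: "length (encode_word_gen (u, x)) = ?N" by (simp add: encode_word_gen_def)
    have P: "poly P m = 10 + 10 * m + 2 * m ^ 2 + poly p (2 * m)" for m
    proof -
      have double: "poly [:0, 2:] m = 2 * m" by simp
      show ?thesis
        unfolding P_def poly_add poly_pcompose double by (simp add: power2_eq_square algebra_simps)
    qed
    note bounds = geodesic_length_snoc[OF assms(1,3) u x]
    show ?thesis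
    proof (cases u)
      case Nil
      have "machine_answer (u, x) (poly P ?N) = Some (if ?L [(x, True)] = 0 then 0 else 1)"
        unfolding Nil by (rule machine_answer_Nil) (use P Nil in simp)
      \<comment> \<open>A single letter has geodesic length at most 1, so the value is 0 or
        1.\<close>
      then show ?thesis
        using bounds(1) Nil N_eq by (auto simp: geodesic_length_Nil)
    next
      case (Cons l w)
      let ?n = "Suc (length w)"
      have answer_T: "answer_at M (encode_word_int (?ux, int m)) (poly p (2 * ?N)) = Some (?L ?ux \<le> m)"
        if "m \<le> ?n" for m
      proof -
        \<comment> \<open>There are \<open>length u + 1\<close> letters, a separator and at most
          \<open>m\<close> digits, where \<open>m\<close> is at most
          \<open>length u\<close>.\<close>
        have "length (encode_word_int (?ux, int m)) \<le> 2 * ?N"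
          using length_encode_nat[of m, where 'a = 'a] that Cons by (simp add: encode_word_int_def)
        from answer_at_mono[OF answer[OF ux] poly_nat_mono[OF this]] show ?thesis by simp
      qed
      have "machine_answer (l # w, x) (poly P ?N)
          = Some (if ?L ?ux \<le> length w then - 1 else if ?L ?ux \<le> ?n then 0 else 1)"
        using alphabet[OF ux] answer_T[of ?n] answer_T[of "length w"] Cons
        by (intro machine_answer_Cons[where T = "poly p (2 * ?N)"])
          (simp_all add: P power2_eq_square)
      \<comment> \<open>The two bounds leave only the lengths n - 1, n and n + 1 with n =
        \<open>length u\<close>, and the two thresholds separate these.\<close>
      then show ?thesis
        using bounds len Cons N_eq by auto
    qed
  qed
  have "geodesic_extension_algorithm G S N"
    unfolding geodesic_extension_algorithm_def
  proof (rule poly_time_space_solvesI[where p = P])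
    fix y assume "y \<in> {(u, x). geodesic_word G S u \<and> x \<in> S}"
    then obtain u x where y: "y = (u, x)" and ux: "geodesic_word G S u" "x \<in> S" by auto
    then have u: "u \<in> words S" by (simp add: geodesic_word_def)
    show "Input ` set (encode_word_gen y) \<subseteq> alphabet N"
      unfolding y N using sub[OF u ux(2)] .
    show "\<exists>v. answer_at N (encode_word_gen y) (poly P (length (encode_word_gen y))) = Some v \<and>
        (case y of (u, x) \<Rightarrow> \<lambda>d. d \<in> {0, 1, - 1} \<and> int (?L (u @ [(x, True)])) - int (?L u) = d) v"
      unfolding y prod.case answer_N[OF sub[OF u ux(2)]] using correct[OF ux] .
  qed (fact N(1))
  then show ?thesis ..
qed

end
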